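(* Let $H:\mathbb{R}\to\mathbb{R}$ be a compactly supported, infinitely differentiable, even function, and let $S\ge 3$. Then there is a constant $c>0$, depending only on $H$ and $S$, such that for all $x,y\in\mathbb{R}$ and all $n\ge1$, $$|\Phi_n(H;x,y)|\le c\,\frac{n}{\max(1,(n|x-y|)^S)},\qquad \left|\frac{\partial}{\partial x}\Phi_n(H;x,y)\right|\le c\,\frac{n^2}{\max(1,(n|x-y|)^S)}.$$
   Context: The orthonormalized Hermite functions are $\psi_j(x)=\frac{(-1)^j}{\pi^{1/4}2^{j/2}\sqrt{j!}}\exp(x^2/2)\left(\frac{d}{dx}\right)^j(\exp(-x^2))$, $x\in\mathbb{R}$, $j=0,1,\dots$. For a compactly supported function $H$ and $n>0$, $$\Phi_n(H;x,y)=\sum_{j=0}^\infty H\left(\frac{\sqrt{j}}{n}\right)\psi_j(x)\psi_j(y),\qquad x,y\in\mathbb{R}.$$ Here $n$ is a real number. *)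

theory Defs
  imports "HOL-Analysis.Analysis"
begin

definition smooth :: "(real \<Rightarrow> real) \<Rightarrow> bool" where
  "smooth f \<longleftrightarrow> (\<forall>k x. (deriv ^^ k) f field_differentiable (at x))"

definition compactly_supported :: "(real \<Rightarrow> real) \<Rightarrow> bool" where
  "compactly_supported f \<longleftrightarrow> compact (closure (support_on UNIV f))"

definition hermite_fun :: "nat \<Rightarrow> real \<Rightarrow> real" where
  "hermite_fun j x =
     (-1) ^ j / (pi powr (1 / 4) * 2 powr (real j / 2) * sqrt (fact j))
       * exp (x\<^sup>2 / 2) * (deriv ^^ j) (\<lambda>t. exp (- t\<^sup>2)) x"

text \<open>For compactly supported \<open>H\<close> and \<open>n > 0\<close> the series below has only finitely many
  nonzero terms.\<close>

definition Phi :: "real \<Rightarrow> (real \<Rightarrow> real) \<Rightarrow> real \<Rightarrow> real \<Rightarrow> real" where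
  "Phi n H x y = (\<Sum>j. H (sqrt (real j) / n) * hermite_fun j x * hermite_fun j y)"

lemma finite_Phi_terms:
  assumes "compactly_supported H" "n > 0"
  shows "finite {j. H (sqrt (real j) / n) \<noteq> 0}"
proof -
  have "bounded (support_on UNIV H)"
    using assms(1) bounded_subset[OF compact_imp_bounded closure_subset]
    unfolding compactly_supported_def by simp
  then obtain B where B: "\<And>x. H x \<noteq> 0 \<Longrightarrow> \<bar>x\<bar> \<le> B"
    by (auto simp: bounded_iff support_on_def)
  have "j \<le> nat \<lceil>(B * n)\<^sup>2\<rceil>" if "H (sqrt (real j) / n) \<noteq> 0" for j
  proof -
    have "sqrt (real j) \<le> B * n"
      using B[OF that] assms(2) by (simp add: field_simps)
    then have "(sqrt (real j))\<^sup>2 \<le> (B * n)\<^sup>2"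
      by (intro power_mono) auto
    then have "real j \<le> real (nat \<lceil>(B * n)\<^sup>2\<rceil>)"
      using real_nat_ceiling_ge order_trans by fastforce
    then show ?thesis by (simp only: of_nat_le_iff)
  qed
  then show ?thesis
    by (auto simp: finite_nat_set_iff_bounded_le)
qed

lemma Phi_eq_sum:
  assumes "compactly_supported H" "n > 0"
  shows "Phi n H x y = (\<Sum>j | H (sqrt (real j) / n) \<noteq> 0.
           H (sqrt (real j) / n) * hermite_fun j x * hermite_fun j y)"
  unfolding Phi_def by (rule suminf_finite[OF finite_Phi_terms[OF assms]]) simp

lemma hermite_fun_field_differentiable: "hermite_fun j field_differentiable (at x)"
proof -
  have "\<exists>p. (deriv ^^ j) (\<lambda>t::real. exp (- t\<^sup>2)) = (\<lambda>t. poly p t * exp (- t\<^sup>2))"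
  proof (induction j)
    case 0
    show ?case by (rule exI[of _ 1]) simp
  next
    case (Suc j)
    then obtain p where p: "(deriv ^^ j) (\<lambda>t::real. exp (- t\<^sup>2)) = (\<lambda>t. poly p t * exp (- t\<^sup>2))"
      by blast
    have "((\<lambda>t. poly p t * exp (- t\<^sup>2)) has_field_derivative
             poly (pderiv p - [:0, 2:] * p) t * exp (- t\<^sup>2)) (at t)" for t
      by (auto intro!: derivative_eq_intros simp: algebra_simps)
    then show ?case
      by (intro exI[of _ "pderiv p - [:0, 2:] * p"]) (auto simp: p intro!: DERIV_imp_deriv)
  qed
  then obtain p where "(deriv ^^ j) (\<lambda>t::real. exp (- t\<^sup>2)) = (\<lambda>t. poly p t * exp (- t\<^sup>2))"
    by blast
  then show ?thesis
    unfolding hermite_fun_def field_differentiable_def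
    by (intro exI) (auto intro!: derivative_eq_intros)
qed

lemma Phi_field_differentiable:
  assumes "compactly_supported H" "n > 0"
  shows "(\<lambda>t. Phi n H t y) field_differentiable (at x)"
  unfolding Phi_eq_sum[OF assms]
  by (intro field_differentiable_sum field_differentiable_mult
      hermite_fun_field_differentiable field_differentiable_const)

end

theory Submission
  imports Defs
begin

text \<open>
  Write \<open>herm j = sqrt (j!) \<psi>\<^sub>j\<close>. By the three-term recurrence, multiplying
  \<open>\<Sum>j. a j * herm (j + p) x * herm (j + q) y / j!\<close> by \<open>sqrt 2 * (x - y)\<close> gives a combination of
  four sums of the same kind: two in which \<open>p\<close> or \<open>q\<close> drops by one, and two in which one of them grows
  by one while \<open>a\<close> is replaced by its forward difference. For \<open>a j = H (sqrt j / n)\<close> the \<open>m\<close>-th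
  difference is \<open>O(n ^ (-2 * m))\<close>, because \<open>t \<mapsto> H (sqrt t)\<close> is smooth up to \<open>0\<close> for smooth even
  \<open>H\<close>. Iterating gives decay of every order in \<open>n * \<bar>x - y\<bar>\<close>, starting from the uniform bound
  \<open>(\<Sum>j<N. (\<psi>\<^sub>j x)\<^sup>2) \<le> sqrt (2 * pi * N)\<close>. The latter holds because the derivative of the left-hand
  side telescopes to \<open>- sqrt (2 * N) * \<psi>\<^sub>N\<^sub>-\<^sub>1 * \<psi>\<^sub>N\<close> and the \<open>(\<psi>\<^sub>j)\<^sup>2\<close> have bounded antiderivatives.
\<close>

section \<open>Hermite functions: recurrence and derivatives\<close>

fun herm :: "nat \<Rightarrow> real \<Rightarrow> real" where
  "herm 0 x = exp (- x\<^sup>2 / 2) / pi powr (1 / 4)"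
| "herm (Suc 0) x = sqrt 2 * x * herm 0 x"
| "herm (Suc (Suc j)) x = sqrt 2 * x * herm (Suc j) x - real (Suc j) * herm j x"

text \<open>Truncated subtraction is harmless: at \<open>j = 0\<close> the factor
  \<open>real j\<close> removes the term with \<open>j - 1\<close>.\<close>

lemma herm_recurrence: "sqrt 2 * x * herm j x = herm (Suc j) x + real j * herm (j - 1) x"
  by (cases "(j, x)" rule: herm.cases) auto

lemma sqrt2_mult_mult: "sqrt 2 * (sqrt 2 * x) = 2 * x"
  by (metis mult.assoc real_sqrt_mult_self abs_numeral)

text \<open>Strong induction along the recurrence, which is differentiated term by term. This
  raising form comes first because in the derivative of
  \<open>exp (- x\<^sup>2 / 2) * herm j x\<close> its term \<open>x * herm j x\<close>
  cancels.\<close>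

lemma has_derivative_herm_raise:
  "(herm j has_field_derivative x * herm j x - sqrt 2 * herm (Suc j) x) (at x)"
proof (induction j arbitrary: x rule: less_induct)
  case (less j)
  consider "j = 0" | "j = Suc 0" | i where "j = Suc (Suc i)"
    by (metis old.nat.exhaust)
  then show ?case
  proof cases
    case 1
    have "((\<lambda>x. exp (- x\<^sup>2 / 2) / pi powr (1 / 4)) has_field_derivative
        - x * (exp (- x\<^sup>2 / 2) / pi powr (1 / 4))) (at x)"
      by (auto intro!: derivative_eq_intros)
    moreover have "herm 0 = (\<lambda>x. exp (- x\<^sup>2 / 2) / pi powr (1 / 4))"
      by (simp add: fun_eq_iff)
    ultimately have "(herm 0 has_field_derivative - x * herm 0 x) (at x)"
      by simp
    moreover have "x * herm 0 x - sqrt 2 * herm (Suc 0) x = - x * herm 0 x"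
      using sqrt2_mult_mult[of "x * herm 0 x"] by (simp add: algebra_simps)
    ultimately show ?thesis unfolding 1 by (simp only:)
  next
    case 2
    have "((\<lambda>x. sqrt 2 * x * herm 0 x) has_field_derivative
       sqrt 2 * herm 0 x + sqrt 2 * x * (x * herm 0 x - sqrt 2 * herm (Suc 0) x)) (at x)"
      by (rule derivative_eq_intros refl less.IH | simp add: 2 del: herm.simps)+
    moreover have "sqrt 2 * herm 0 x + sqrt 2 * x * (x * herm 0 x - sqrt 2 * herm (Suc 0) x)
       = x * herm (Suc 0) x - sqrt 2 * herm (Suc (Suc 0)) x"
      by (simp add: algebra_simps)
    moreover have "herm (Suc 0) = (\<lambda>x. sqrt 2 * x * herm 0 x)"
      by (simp add: fun_eq_iff)
    ultimately show ?thesis using 2 by (simp del: herm.simps)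
  next
    case 3
    have "((\<lambda>x. sqrt 2 * x * herm (Suc i) x - real (Suc i) * herm i x) has_field_derivative
       sqrt 2 * herm (Suc i) x + sqrt 2 * x * (x * herm (Suc i) x - sqrt 2 * herm (Suc (Suc i)) x)
         - real (Suc i) * (x * herm i x - sqrt 2 * herm (Suc i) x)) (at x)"
      by (rule derivative_eq_intros refl less.IH | simp add: 3 del: herm.simps)+
    moreover have "sqrt 2 * herm (Suc i) x + sqrt 2 * x * (x * herm (Suc i) x - sqrt 2 * herm (Suc (Suc i)) x)
         - real (Suc i) * (x * herm i x - sqrt 2 * herm (Suc i) x)
       = x * herm (Suc (Suc i)) x - sqrt 2 * herm (Suc (Suc (Suc i))) x"
      by (simp add: algebra_simps)
    moreover have "herm (Suc (Suc i)) = (\<lambda>x. sqrt 2 * x * herm (Suc i) x - real (Suc i) * herm i x)"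
      by (simp add: fun_eq_iff)
    ultimately show ?thesis using 3 by (simp del: herm.simps)
  qed
qed

text \<open>Eliminating \<open>x * herm j x\<close> by the recurrence leaves only neighbouring
  indices with constant coefficients; sums of derivatives can then telescope or be shifted.\<close>

lemma has_derivative_herm:
  "(herm j has_field_derivative (real j * herm (j - 1) x - herm (Suc j) x) / sqrt 2) (at x)"
proof -
  have "sqrt 2 * (x * herm j x - sqrt 2 * herm (Suc j) x) = real j * herm (j - 1) x - herm (Suc j) x"
    using herm_recurrence[of x j] sqrt2_mult_mult[of "herm (Suc j) x"]
    by (simp add: algebra_simps del: herm.simps)
  then have "x * herm j x - sqrt 2 * herm (Suc j) x = (real j * herm (j - 1) x - herm (Suc j) x) / sqrt 2"
    by (simp add: field_simps del: herm.simps)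
  with has_derivative_herm_raise[of j x] show ?thesis by simp
qed

text \<open>The Rodrigues formula: each derivative of
  \<open>exp (- x\<^sup>2 / 2) * herm j x\<close> raises the index and contributes a factor
  \<open>- sqrt 2\<close>.\<close>

lemma deriv_gaussian_herm:
  "(deriv ^^ j) (\<lambda>t. exp (- t\<^sup>2)) =
     (\<lambda>x. (-1) ^ j * (pi powr (1 / 4) * sqrt 2 ^ j) * (exp (- x\<^sup>2 / 2) * herm j x))"
proof (induction j)
  case 0
  have "exp (- (x\<^sup>2)) = exp (- x\<^sup>2 / 2) * exp (- x\<^sup>2 / 2)" for x :: real
    by (simp flip: exp_add)
  then show ?case by (simp add: fun_eq_iff)
next
  case (Suc j)
  have "((\<lambda>x. c * (exp (- x\<^sup>2 / 2) * herm j x)) has_field_derivative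
      c * (exp (- x\<^sup>2 / 2) * (- sqrt 2 * herm (Suc j) x))) (at x)" for c x
    by (rule derivative_eq_intros refl has_derivative_herm_raise | simp add: algebra_simps del: herm.simps)+
  from DERIV_imp_deriv[OF this] show ?case
    by (simp add: Suc fun_eq_iff del: herm.simps)
qed

lemma hermite_fun_eq: "hermite_fun j x = herm j x / sqrt (fact j)"
proof -
  have "2 powr (real j / 2) = sqrt 2 ^ j"
    by (simp add: powr_half_sqrt[symmetric] powr_powr flip: powr_realpow)
  moreover have "exp (x\<^sup>2 / 2) * exp (- x\<^sup>2 / 2) = 1"
    by (simp flip: exp_add)
  moreover have "(- 1 :: real) ^ j * (- 1) ^ j = 1"
    by (simp flip: power_add)
  ultimately show ?thesis
    unfolding hermite_fun_def deriv_gaussian_herm by (simp add: field_simps del: herm.simps)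
qed

section \<open>Decay of the Hermite functions at infinity\<close>

lemma tendsto_power_mult_gaussian: "((\<lambda>x::real. x ^ k * exp (- x\<^sup>2 / 2)) \<longlongrightarrow> 0) at_infinity"
proof (rule tendsto_norm_zero_cancel, rule tendsto_sandwich[OF _ _ tendsto_const])
  have "((\<lambda>x. norm x ^ k / exp (norm x)) \<longlongrightarrow> 0) (at_infinity :: real filter)"
    by (rule filterlim_compose[OF tendsto_power_div_exp_0 filterlim_norm_at_top])
  then show "((\<lambda>x::real. exp (1 / 2) * (norm x ^ k / exp (norm x))) \<longlongrightarrow> 0) at_infinity"
    by (intro tendsto_mult_right_zero)
  show "\<forall>\<^sub>F x::real in at_infinity. norm (x ^ k * exp (- x\<^sup>2 / 2)) \<le> exp (1 / 2) * (norm x ^ k / exp (norm x))"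
  proof (rule always_eventually, rule allI)
    fix x :: real
    \<comment> \<open>Completing the square replaces the Gaussian by
      \<open>exp (1 / 2) * exp (- \<bar>x\<bar>)\<close>, whose decay against powers is
      known.\<close>
    have "0 \<le> (\<bar>x\<bar> - 1)\<^sup>2" by simp
    then have "- x\<^sup>2 / 2 \<le> 1 / 2 - \<bar>x\<bar>" by (simp add: power2_diff)
    then have "exp (- x\<^sup>2 / 2) \<le> exp (1 / 2) / exp \<bar>x\<bar>" by (simp flip: exp_diff)
    then have "\<bar>x\<bar> ^ k * exp (- x\<^sup>2 / 2) \<le> \<bar>x\<bar> ^ k * (exp (1 / 2) / exp \<bar>x\<bar>)"
      by (intro mult_left_mono) auto
    then show "norm (x ^ k * exp (- x\<^sup>2 / 2)) \<le> exp (1 / 2) * (norm x ^ k / exp (norm x))"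
      by (simp add: abs_mult power_abs mult_ac)
  qed
qed auto

text \<open>Only \<open>k = 0\<close> is used later; the arbitrary power lets the induction absorb
  the factor \<open>x\<close> of the recurrence.\<close>

lemma tendsto_power_mult_herm: "((\<lambda>x. x ^ k * herm j x) \<longlongrightarrow> 0) at_infinity"
proof (induction j arbitrary: k rule: less_induct)
  case (less j)
  consider "j = 0" | "j = Suc 0" | i where "j = Suc (Suc i)"
    by (metis old.nat.exhaust)
  then show ?case
  proof cases
    case 1
    show ?thesis
      using tendsto_mult_left_zero[OF tendsto_power_mult_gaussian[of k], of "1 / pi powr (1/4)"] 1 by simp
  next
    case 2
    show ?thesis
      using tendsto_mult_right_zero[OF less.IH[of 0 "Suc k"], of "sqrt 2"] 2 by (simp add: mult_ac)
  next
    case 3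
    have "((\<lambda>x. sqrt 2 * (x ^ Suc k * herm (Suc i) x) - real (Suc i) * (x ^ k * herm i x)) \<longlongrightarrow> 0) at_infinity"
      using tendsto_diff[OF tendsto_mult_right_zero[OF less.IH[of "Suc i" "Suc k"], of "sqrt 2"]
          tendsto_mult_right_zero[OF less.IH[of i k], of "real (Suc i)"]] 3
      by (simp del: herm.simps power_Suc of_nat_Suc)
    then show ?thesis using 3 by (simp add: algebra_simps)
  qed
qed

lemma tendsto_herm: "(herm j \<longlongrightarrow> 0) at_infinity"
  using tendsto_power_mult_herm[of 0 j] by simp

section \<open>Uniform bound for the sum of squared Hermite functions\<close>

text \<open>The derivatives of \<open>Q j\<close> and of an antiderivative of the squared \<open>j\<close>-th orthonormal Hermite
  function differ by the same nonnegative amount for every \<open>j\<close>; starting from \<open>arctan\<close> instead of the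
  error function keeps the limits at infinity explicit.\<close>

primrec Q :: "nat \<Rightarrow> real \<Rightarrow> real" where
  "Q 0 x = arctan x / sqrt pi"
| "Q (Suc j) x = Q j x - herm j x * herm (Suc j) x / (sqrt 2 * fact (Suc j))"

lemma DERIV_Q:
  "(Q j has_field_derivative
     (herm j x)\<^sup>2 / fact j + (1 / (sqrt pi * (1 + x\<^sup>2)) - (herm 0 x)\<^sup>2)) (at x)"
proof (induction j)
  case 0
  have "Q 0 = (\<lambda>x. arctan x / sqrt pi)" by (simp add: fun_eq_iff)
  moreover have "((\<lambda>x. arctan x / sqrt pi) has_field_derivative 1 / (sqrt pi * (1 + x\<^sup>2))) (at x)"
    using DERIV_cdivide[OF DERIV_arctan, of "sqrt pi"]
    by (simp add: field_simps)
  ultimately show ?case by simp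
next
  case (Suc j)
  \<comment> \<open>The left-hand side is the product rule for \<open>herm j * herm (Suc j)\<close>,
    with the raising form for the first factor and the two-term form for the second. The terms with
    \<open>x\<close> cancel, and division by \<open>sqrt 2 * fact (Suc j)\<close> leaves the
    difference of two consecutive normalized squares.\<close>
  have eq: "(x * a - sqrt 2 * b) * b + a * ((real (Suc j) * a - c) / sqrt 2)
     = sqrt 2 * (real (Suc j) * a\<^sup>2 - b\<^sup>2)"
    if "sqrt 2 * x * b = c + real (Suc j) * a" for a b c
  proof -
    have "c = sqrt 2 * x * b - real (Suc j) * a" using that by simp
    then have "(real (Suc j) * a - c) / sqrt 2 = sqrt 2 * real (Suc j) * a - x * b"
      by (simp add: field_simps sqrt2_mult_mult)
    then show ?thesis by (simp only:) (simp add: power2_eq_square algebra_simps)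
  qed
  have Q: "Q (Suc j) = (\<lambda>x. Q j x - herm j x * herm (Suc j) x / (sqrt 2 * fact (Suc j)))"
    by (simp add: fun_eq_iff)
  have "((\<lambda>x. Q j x - herm j x * herm (Suc j) x / (sqrt 2 * fact (Suc j))) has_field_derivative
    ((herm j x)\<^sup>2 / fact j + (1 / (sqrt pi * (1 + x\<^sup>2)) - (herm 0 x)\<^sup>2))
    - (sqrt 2 * (real (Suc j) * (herm j x)\<^sup>2 - (herm (Suc j) x)\<^sup>2)) / (sqrt 2 * fact (Suc j))) (at x)"
    using eq[OF herm_recurrence[of x "Suc j", simplified diff_Suc_1]]
    by (intro DERIV_diff[OF Suc] DERIV_cdivide)
      (rule derivative_eq_intros has_derivative_herm_raise has_derivative_herm refl
        | simp del: herm.simps add: algebra_simps)+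
  note deriv = this
  have "(sqrt 2 * (real (Suc j) * u - v)) / (sqrt 2 * fact (Suc j)) = u / fact j - v / fact (Suc j)" for u v
    by (simp add: divide_simps)
  then have "(herm j x)\<^sup>2 / fact j + (1 / (sqrt pi * (1 + x\<^sup>2)) - (herm 0 x)\<^sup>2)
      - (sqrt 2 * (real (Suc j) * (herm j x)\<^sup>2 - (herm (Suc j) x)\<^sup>2)) / (sqrt 2 * fact (Suc j))
    = (herm (Suc j) x)\<^sup>2 / fact (Suc j) + (1 / (sqrt pi * (1 + x\<^sup>2)) - (herm 0 x)\<^sup>2)"
    by (simp only: diff_conv_add_uminus)
  from DERIV_cong[OF deriv this] show ?case
    by (simp only: Q)
qed

text \<open>This is \<open>1 + t \<le> exp t\<close> at \<open>t = x\<^sup>2\<close>. It makes the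
  correction in \<open>DERIV_Q\<close> nonnegative.\<close>

lemma herm_0_square_le: "(herm 0 x)\<^sup>2 \<le> 1 / (sqrt pi * (1 + x\<^sup>2))"
proof -
  have "(herm 0 x)\<^sup>2 = 1 / (sqrt pi * exp (x\<^sup>2))"
  proof -
    have "(pi powr (1/4))\<^sup>2 = sqrt pi"
      by (simp add: powr_half_sqrt powr_powr flip: powr_realpow)
    moreover have "(exp (- x\<^sup>2 / 2))\<^sup>2 = 1 / exp (x\<^sup>2)"
      by (simp add: exp_minus inverse_eq_divide power_divide flip: exp_double)
    ultimately show ?thesis by (simp add: power_divide)
  qed
  also have "\<dots> \<le> 1 / (sqrt pi * (1 + x\<^sup>2))"
    by (intro divide_left_mono mult_left_mono exp_ge_add_one_self) (auto simp: add_pos_nonneg)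
  finally show ?thesis .
qed

lemma DERIV_Q_ge: "\<exists>d. (Q j has_field_derivative d) (at x) \<and> (herm j x)\<^sup>2 / fact j \<le> d"
  using DERIV_Q[of j x] herm_0_square_le[of x] by fastforce

text \<open>Passing from \<open>Q j\<close> to \<open>Q (Suc j)\<close> subtracts a product that
  vanishes at infinity, so the limits are those of \<open>arctan x / sqrt pi\<close> for every
  \<open>j\<close>.\<close>

lemma tendsto_Q_at_top: "(Q j \<longlongrightarrow> sqrt pi / 2) at_top"
  and tendsto_Q_at_bot: "(Q j \<longlongrightarrow> - (sqrt pi / 2)) at_bot"
proof (induction j)
  case 0
  have Q0: "Q 0 = (\<lambda>x. arctan x / sqrt pi)" by (simp add: fun_eq_iff)
  have e: "pi / 2 / sqrt pi = sqrt pi / 2" by (simp add: field_simps)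
  then have e': "- (sqrt pi / 2) = - (pi / 2) / sqrt pi" by simp
  { case 1 show ?case unfolding Q0 e[symmetric] by (intro tendsto_divide tendsto_const tendsto_arctan_at_top) simp }
  { case 2 show ?case unfolding Q0 e'
      by (intro tendsto_divide tendsto_const tendsto_arctan_at_bot) simp }
next
  case (Suc j)
  have QS: "Q (Suc j) = (\<lambda>x. Q j x - herm j x * herm (Suc j) x / (sqrt 2 * fact (Suc j)))"
    by (simp add: fun_eq_iff)
  have lim: "((\<lambda>x. herm j x * herm (Suc j) x / (sqrt 2 * fact (Suc j))) \<longlongrightarrow> 0) at_infinity"
    by (intro tendsto_divide_zero tendsto_mult_zero tendsto_herm)
  { case 1 show ?case unfolding QS
      using tendsto_diff[OF Suc(1) filterlim_mono[OF lim order_refl at_top_le_at_infinity]] by simp }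
  { case 2 show ?case unfolding QS
      using tendsto_diff[OF Suc(2) filterlim_mono[OF lim order_refl at_bot_le_at_infinity]] by simp }
qed

lemma mono_le_limit_at_top:
  fixes f :: "real \<Rightarrow> real"
  assumes "mono f" "(f \<longlongrightarrow> l) at_top"
  shows "f x \<le> l"
  using assms(1) by (intro tendsto_lowerbound[OF assms(2)])
    (auto intro!: eventually_mono[OF eventually_ge_at_top[of x]] dest: monoD)

lemma limit_at_bot_le_mono:
  fixes f :: "real \<Rightarrow> real"
  assumes "mono f" "(f \<longlongrightarrow> l) at_bot"
  shows "l \<le> f x"
  using assms(1) by (intro tendsto_upperbound[OF assms(2)])
    (auto intro!: eventually_mono[OF eventually_le_at_bot[of x]] dest: monoD)

lemma mono_if_DERIV_nonneg:
  fixes f :: "real \<Rightarrow> real"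
  assumes "\<And>x. \<exists>d. (f has_field_derivative d) (at x) \<and> 0 \<le> d"
  shows "mono f"
  by (rule monoI, rule DERIV_nonneg_imp_nondecreasing) (use assms in auto)

lemma Q_ge: "- (sqrt pi / 2) \<le> Q j x"
proof (rule limit_at_bot_le_mono[OF mono_if_DERIV_nonneg tendsto_Q_at_bot])
  fix x
  have "0 \<le> (herm j x)\<^sup>2 / fact j" by simp
  with DERIV_Q_ge[of j x] show "\<exists>d. (Q j has_field_derivative d) (at x) \<and> 0 \<le> d"
    by (meson order_trans)
qed

definition herm_square_sum :: "nat \<Rightarrow> real \<Rightarrow> real" where
  "herm_square_sum N x = (\<Sum>j<N. (herm j x)\<^sup>2 / fact j)"

text \<open>The derivative of each square is a difference of products of neighbouring Hermite
  functions; the sum telescopes and only the product at the upper end survives.\<close>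

lemma DERIV_herm_square_sum:
  "(herm_square_sum (Suc N) has_field_derivative - (sqrt 2 * herm N x * herm (Suc N) x / fact N)) (at x)"
proof (induction N)
  case 0
  have "herm_square_sum (Suc 0) = (\<lambda>x. (herm 0 x)\<^sup>2)" by (simp add: fun_eq_iff herm_square_sum_def)
  moreover have "((\<lambda>x. (herm 0 x)\<^sup>2) has_field_derivative 2 * herm 0 x * (- herm (Suc 0) x / sqrt 2)) (at x)"
    by (rule derivative_eq_intros has_derivative_herm refl | simp del: herm.simps)+
  moreover have "2 * a * (- b / sqrt 2) = - (sqrt 2 * a * b)" for a b
    by (simp add: field_simps sqrt2_mult_mult)
  ultimately show ?case by (simp del: herm.simps)
next
  case (Suc N)
  have "herm_square_sum (Suc (Suc N)) = (\<lambda>x. herm_square_sum (Suc N) x + (herm (Suc N) x)\<^sup>2 / fact (Suc N))"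
    by (simp add: fun_eq_iff herm_square_sum_def)
  moreover have "((\<lambda>x. herm_square_sum (Suc N) x + (herm (Suc N) x)\<^sup>2 / fact (Suc N)) has_field_derivative
     - (sqrt 2 * herm N x * herm (Suc N) x / fact N) +
     (2 * herm (Suc N) x * ((real (Suc N) * herm N x - herm (Suc (Suc N)) x) / sqrt 2)) / fact (Suc N)) (at x)"
    by (intro DERIV_add[OF Suc] DERIV_cdivide)
      (rule derivative_eq_intros has_derivative_herm refl | simp del: herm.simps)+
  moreover have "- (sqrt 2 * a * b / fact N) + (2 * b * ((real (Suc N) * a - c) / sqrt 2)) / fact (Suc N)
     = - (sqrt 2 * b * c / fact (Suc N))" for a b c
  proof -
    have "2 * b * ((real (Suc N) * a - c) / sqrt 2) = sqrt 2 * b * (real (Suc N) * a - c)"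
      by (simp add: field_simps sqrt2_mult_mult)
    then show ?thesis by (simp add: divide_simps) (simp add: algebra_simps)
  qed
  ultimately show ?case by (simp del: herm.simps fact_Suc)
qed

lemma herm_square_sum_le: "herm_square_sum N x \<le> sqrt (2 * pi * real N)"
proof (cases N)
  case (Suc K)
  define r where "r = sqrt (real (Suc K))"
  \<comment> \<open>The added multiple of \<open>Q K + Q (Suc K)\<close> is just large enough to
    make \<open>f\<close> increasing. Then \<open>f\<close> lies below its limit at infinity, where
    the sum of squares vanishes, and the lower bounds on \<open>Q\<close> give the claim.\<close>
  define f where "f x = herm_square_sum (Suc K) x + r / sqrt 2 * (Q K x + Q (Suc K) x)" for x
  have r: "r > 0" "r\<^sup>2 = real (Suc K)" by (auto simp: r_def)
  have "mono f"
  proof (rule mono_if_DERIV_nonneg)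
    fix x
    obtain d e where d: "(Q K has_field_derivative d) (at x)" "(herm K x)\<^sup>2 / fact K \<le> d"
      and e: "(Q (Suc K) has_field_derivative e) (at x)" "(herm (Suc K) x)\<^sup>2 / fact (Suc K) \<le> e"
      using DERIV_Q_ge by meson
    have "(f has_field_derivative - (sqrt 2 * herm K x * herm (Suc K) x / fact K) + r / sqrt 2 * (d + e)) (at x)"
      unfolding f_def by (intro DERIV_add DERIV_herm_square_sum DERIV_cmult d e)
    moreover have "sqrt 2 * herm K x * herm (Suc K) x / fact K
       \<le> r / sqrt 2 * ((herm K x)\<^sup>2 / fact K + (herm (Suc K) x)\<^sup>2 / fact (Suc K))"
    proof -
      define a b where "a = herm K x" and "b = herm (Suc K) x"
      \<comment> \<open>The weight \<open>r\<close> matches the normalizations: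
        \<open>fact (Suc K) = r\<^sup>2 * fact K\<close>.\<close>
      have "0 \<le> (r * a - b)\<^sup>2" by simp
      then have "2 * (r * (a * b)) \<le> r\<^sup>2 * a\<^sup>2 + b\<^sup>2"
        by (simp add: power2_diff power_mult_distrib mult_ac)
      also have "r\<^sup>2 * a\<^sup>2 + b\<^sup>2 = r * (r * (a\<^sup>2 + b\<^sup>2 / r\<^sup>2))"
        using r(1) by (simp add: field_simps power2_eq_square)
      also have "2 * (r * (a * b)) = r * (2 * (a * b))" by simp
      finally have "2 * (a * b) \<le> r * (a\<^sup>2 + b\<^sup>2 / r\<^sup>2)"
        using r(1) by (simp only: mult_le_cancel_left_pos)
      then have "2 * (a * b) / fact K \<le> r * (a\<^sup>2 + b\<^sup>2 / r\<^sup>2) / fact K"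
        by (intro divide_right_mono) auto
      also have "\<dots> = r * (a\<^sup>2 / fact K + b\<^sup>2 / fact (Suc K))"
        unfolding r(2) by (simp add: add_divide_distrib distrib_left mult_ac)
      finally have "2 * (a * b) / fact K / sqrt 2 \<le> r * (a\<^sup>2 / fact K + b\<^sup>2 / fact (Suc K)) / sqrt 2"
        by (intro divide_right_mono) auto
      moreover have "2 * (a * b) / fact K / sqrt 2 = sqrt 2 * a * b / fact K"
        by (simp add: field_simps sqrt2_mult_mult)
      ultimately show ?thesis unfolding a_def b_def by simp
    qed
    moreover have "r / sqrt 2 * ((herm K x)\<^sup>2 / fact K + (herm (Suc K) x)\<^sup>2 / fact (Suc K)) \<le> r / sqrt 2 * (d + e)"
      using r(1) d(2) e(2) by (intro mult_left_mono add_mono) auto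
    ultimately show "\<exists>d. (f has_field_derivative d) (at x) \<and> 0 \<le> d"
      by force
  qed
  moreover have "(f \<longlongrightarrow> r / sqrt 2 * (sqrt pi / 2 + sqrt pi / 2)) at_top"
  proof -
    have "((\<lambda>x. (herm j x)\<^sup>2 / fact j) \<longlongrightarrow> 0) at_top" for j
      using tendsto_divide_zero[OF tendsto_mult_zero[OF tendsto_herm tendsto_herm]]
      by (auto simp: power2_eq_square intro!: filterlim_mono[OF _ order_refl at_top_le_at_infinity])
    then have "(herm_square_sum (Suc K) \<longlongrightarrow> 0) at_top"
      unfolding herm_square_sum_def by (intro tendsto_null_sum)
    then have "(f \<longlongrightarrow> 0 + r / sqrt 2 * (sqrt pi / 2 + sqrt pi / 2)) at_top"
      unfolding f_def by (intro tendsto_intros tendsto_Q_at_top)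
    then show ?thesis by simp
  qed
  ultimately have "f x \<le> r / sqrt 2 * (sqrt pi / 2 + sqrt pi / 2)"
    by (rule mono_le_limit_at_top)
  moreover have "r / sqrt 2 * - sqrt pi \<le> r / sqrt 2 * (Q K x + Q (Suc K) x)"
    using r(1) Q_ge[of K x] Q_ge[of "Suc K" x] by (intro mult_left_mono) auto
  ultimately have "herm_square_sum (Suc K) x \<le> 2 * (r / sqrt 2 * sqrt pi)"
    unfolding f_def by simp
  also have "\<dots> = sqrt 2 * sqrt pi * r"
    by (simp add: field_simps sqrt2_mult_mult)
  also have "\<dots> = sqrt (2 * pi * real N)"
    by (simp only: r_def Suc real_sqrt_mult)
  finally show ?thesis by (simp add: Suc)
qed (simp add: herm_square_sum_def)

section \<open>Kernel sums with shifted indices\<close>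

definition fdiff :: "(nat \<Rightarrow> real) \<Rightarrow> nat \<Rightarrow> real" where
  "fdiff a j = a (Suc j) - a j"

text \<open>Dividing by \<open>fact j\<close> whatever the shifts \<open>p\<close> and
  \<open>q\<close> keeps this family closed under multiplication by \<open>x - y\<close>. With
  \<open>p = q = 0\<close> the denominator is the exact normalization.\<close>

definition kern :: "nat \<Rightarrow> nat \<Rightarrow> nat \<Rightarrow> (nat \<Rightarrow> real) \<Rightarrow> real \<Rightarrow> real \<Rightarrow> real" where
  "kern M p q a x y = (\<Sum>j<M. a j * (herm (j + p) x * herm (j + q) y / fact j))"

text \<open>Cancelling \<open>j\<close> against \<open>j!\<close> and reindexing leaves no boundary
  terms: the factor \<open>j\<close> removes the one at \<open>0\<close>, and \<open>a M = 0\<close>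
  the one at \<open>M\<close>.\<close>

lemma sum_fact_shift:
  fixes a f :: "nat \<Rightarrow> real"
  assumes "a M = 0"
  shows "(\<Sum>j<M. a j * (real j * f j / fact j)) = (\<Sum>j<M. a (Suc j) * (f (Suc j) / fact j))"
proof -
  define h where "h j = a j * (real j * f j / fact j)" for j
  have "(\<Sum>j<M. h j) = (\<Sum>j<Suc M. h j)"
    using assms by (simp add: h_def)
  also have "\<dots> = (\<Sum>j<M. h (Suc j))"
    by (subst sum.lessThan_Suc_shift) (simp add: h_def)
  also have "\<dots> = (\<Sum>j<M. a (Suc j) * (f (Suc j) / fact j))"
    unfolding h_def by (intro sum.cong refl) (simp add: divide_simps)
  finally show ?thesis by (simp add: h_def)
qed

lemma kern_fdiff: "kern M p q (fdiff a) x y = kern M p q (\<lambda>j. a (Suc j)) x y - kern M p q a x y"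
  by (simp add: kern_def fdiff_def left_diff_distrib diff_divide_distrib sum_subtractf)

text \<open>The recurrence is applied in \<open>x\<close> and in \<open>y\<close>, and the lowering
  coefficient \<open>j + p\<close> is split. The part \<open>p\<close> stays as a lowered sum; the
  part \<open>j\<close> is reindexed and becomes a sum with a raised index in the other variable and
  coefficients \<open>a (Suc j)\<close>. It pairs with the raising term of opposite sign into a
  forward difference.\<close>

lemma kern_mult_diff:
  assumes "a M = 0"
  shows "sqrt 2 * (x - y) * kern M p q a x y =
      real p * kern M (p - 1) q a x y + kern M p (Suc q) (fdiff a) x y
    - kern M (Suc p) q (fdiff a) x y - real q * kern M p (q - 1) a x y"
proof -
  define U V where "U j = herm (j + p - 1) x * herm (j + q) y"
    and "V j = herm (j + p) x * herm (j + q - 1) y" for j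
  have "sqrt 2 * (x - y) * (a j * (herm (j + p) x * herm (j + q) y / fact j)) =
      real p * (a j * (herm (j + (p - 1)) x * herm (j + q) y / fact j))
      + a j * (real j * U j / fact j)
      + a j * (herm (j + Suc p) x * herm (j + q) y / fact j)
      - real q * (a j * (herm (j + p) x * herm (j + (q - 1)) y / fact j))
      - a j * (real j * V j / fact j)
      - a j * (herm (j + p) x * herm (j + Suc q) y / fact j)" for j
  proof -
    have "sqrt 2 * (x - y) * (herm (j + p) x * herm (j + q) y)
       = (sqrt 2 * x * herm (j + p) x) * herm (j + q) y - herm (j + p) x * (sqrt 2 * y * herm (j + q) y)"
      by (simp add: algebra_simps)
    also have "\<dots> = (herm (j + Suc p) x + real (j + p) * herm (j + p - 1) x) * herm (j + q) y
        - herm (j + p) x * (herm (j + Suc q) y + real (j + q) * herm (j + q - 1) y)"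
      by (simp add: herm_recurrence del: herm.simps)
    also have "\<dots> = real p * (herm (j + (p - 1)) x * herm (j + q) y) + real j * U j
        + herm (j + Suc p) x * herm (j + q) y
        - real q * (herm (j + p) x * herm (j + (q - 1)) y) - real j * V j
        - herm (j + p) x * herm (j + Suc q) y"
      by (cases p; cases q) (simp_all add: U_def V_def algebra_simps del: herm.simps)
    finally have "sqrt 2 * (x - y) * (herm (j + p) x * herm (j + q) y) * (a j / fact j) = \<dots> * (a j / fact j)"
      by simp
    then show ?thesis
      by (simp add: algebra_simps add_divide_distrib diff_divide_distrib del: herm.simps)
  qed
  then have "sqrt 2 * (x - y) * kern M p q a x y =
      real p * kern M (p - 1) q a x y + (\<Sum>j<M. a j * (real j * U j / fact j))
      + kern M (Suc p) q a x y
      - real q * kern M p (q - 1) a x y - (\<Sum>j<M. a j * (real j * V j / fact j))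
      - kern M p (Suc q) a x y"
    unfolding kern_def by (simp only: sum_distrib_left sum.distrib sum_subtractf)
  moreover have "(\<Sum>j<M. a j * (real j * U j / fact j)) = kern M p (Suc q) (\<lambda>j. a (Suc j)) x y"
    "(\<Sum>j<M. a j * (real j * V j / fact j)) = kern M (Suc p) q (\<lambda>j. a (Suc j)) x y"
    by (simp_all only: sum_fact_shift[of a, OF assms]) (simp_all add: kern_def U_def V_def del: herm.simps)
  ultimately show ?thesis
    by (simp add: kern_fdiff)
qed

lemma fact_add_le: "j + p \<le> N \<Longrightarrow> fact (j + p) \<le> (fact j * real N ^ p :: real)"
proof (induction p)
  case (Suc p)
  have "fact (j + Suc p) = real (j + Suc p) * (fact (j + p) :: real)" by simp
  also have "\<dots> \<le> real N * (fact j * real N ^ p)"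
    using Suc by (intro mult_mono) auto
  finally show ?case by (simp add: mult_ac)
qed simp

lemma abs_mult_le_weighted_squares:
  fixes u v A B :: real
  assumes "A > 0" "B > 0"
  shows "\<bar>u * v\<bar> \<le> sqrt A * sqrt B * ((u\<^sup>2 / A + v\<^sup>2 / B) / 2)"
proof -
  define s t where "s = \<bar>u\<bar> / sqrt A" and "t = \<bar>v\<bar> / sqrt B"
  have "0 \<le> (s - t)\<^sup>2" by simp
  then have "s * t \<le> (s\<^sup>2 + t\<^sup>2) / 2" by (simp add: power2_diff)
  then have "sqrt A * sqrt B * (s * t) \<le> sqrt A * sqrt B * ((s\<^sup>2 + t\<^sup>2) / 2)"
    using assms by (intro mult_left_mono) auto
  moreover have "sqrt A * sqrt B * (s * t) = \<bar>u * v\<bar>" "s\<^sup>2 = u\<^sup>2 / A" "t\<^sup>2 = v\<^sup>2 / B"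
    using assms by (auto simp: s_def t_def abs_mult power_divide)
  ultimately show ?thesis by simp
qed

lemma sum_herm_square_shift_le: "(\<Sum>j<M. (herm (j + p) x)\<^sup>2 / fact (j + p)) \<le> sqrt (2 * pi * real (M + p))"
proof -
  have "(\<Sum>j<M. (herm (j + p) x)\<^sup>2 / fact (j + p)) = (\<Sum>j\<in>{0 + p..<M + p}. (herm j x)\<^sup>2 / fact j)"
    by (simp only: sum.shift_bounds_nat_ivl lessThan_atLeast0)
  also have "\<dots> \<le> herm_square_sum (M + p) x"
    unfolding herm_square_sum_def by (intro sum_mono2) auto
  also have "\<dots> \<le> sqrt (2 * pi * real (M + p))"
    by (rule herm_square_sum_le)
  finally show ?thesis .
qed

text \<open>Weighted AM-GM bounds each product by normalized squares at the cost of
  \<open>sqrt ((j + p)! * (j + q)!) / j!\<close>, which is at most \<open>R ^ (p + q)\<close>. The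
  uniform bound on the sums of squares supplies one more factor \<open>R\<close>.\<close>

lemma kern_le:
  assumes a: "\<And>j. \<bar>a j\<bar> \<le> K"
  shows "\<bar>kern M p q a x y\<bar> \<le> K * sqrt (2 * pi) * sqrt (real (M + p + q)) ^ (p + q + 1)"
proof -
  define N where "N = M + p + q"
  define R where "R = sqrt (real N)"
  define X Y where "X j = (herm (j + p) x)\<^sup>2 / fact (j + p)"
    and "Y j = (herm (j + q) y)\<^sup>2 / fact (j + q)" for j
  have R: "R \<ge> 0" by (simp add: R_def)
  have K: "K \<ge> 0" using a[of 0] by simp
  have root: "sqrt (fact (j + r)) \<le> sqrt (fact j) * R ^ r" if "j + r \<le> N" for j r
    using real_sqrt_le_mono[OF fact_add_le[OF that]] by (simp add: R_def real_sqrt_mult real_sqrt_power)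
  have le: "\<bar>a j * (herm (j + p) x * herm (j + q) y / fact j)\<bar> \<le> K * R ^ (p + q) / 2 * (X j + Y j)"
    if "j < M" for j
  proof -
    have "sqrt (fact (j + p)) * sqrt (fact (j + q)) \<le> (sqrt (fact j) * R ^ p) * (sqrt (fact j) * R ^ q)"
      using that R by (intro mult_mono root) (auto simp: N_def)
    also have "\<dots> = fact j * R ^ (p + q)"
      by (simp add: power_add mult_ac)
    finally have "sqrt (fact (j + p)) * sqrt (fact (j + q)) \<le> fact j * R ^ (p + q)" .
    then have "sqrt (fact (j + p)) * sqrt (fact (j + q)) * ((X j + Y j) / 2) \<le> fact j * R ^ (p + q) * ((X j + Y j) / 2)"
      by (intro mult_right_mono) (auto simp: X_def Y_def)
    then have "\<bar>herm (j + p) x * herm (j + q) y\<bar> \<le> fact j * R ^ (p + q) * ((X j + Y j) / 2)"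
      using abs_mult_le_weighted_squares[of "fact (j + p)" "fact (j + q)" "herm (j + p) x" "herm (j + q) y"]
      unfolding X_def Y_def by (simp del: herm.simps)
    then have "\<bar>herm (j + p) x * herm (j + q) y\<bar> / fact j \<le> R ^ (p + q) * ((X j + Y j) / 2)"
      by (simp add: field_simps del: herm.simps)
    then have "\<bar>a j\<bar> * (\<bar>herm (j + p) x * herm (j + q) y\<bar> / fact j) \<le> K * (R ^ (p + q) * ((X j + Y j) / 2))"
      using a K by (intro mult_mono) auto
    then show ?thesis by (simp add: abs_mult del: herm.simps)
  qed
  have "sqrt (2 * pi * real (M + r)) \<le> sqrt (2 * pi) * R" if "r \<le> p + q" for r
    unfolding R_def real_sqrt_mult[symmetric] using that
    by (intro real_sqrt_le_mono mult_left_mono) (auto simp: N_def)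
  then have sums: "(\<Sum>j<M. X j) \<le> sqrt (2 * pi) * R" "(\<Sum>j<M. Y j) \<le> sqrt (2 * pi) * R"
    unfolding X_def Y_def by (auto intro: order_trans[OF sum_herm_square_shift_le])
  have "\<bar>kern M p q a x y\<bar> \<le> (\<Sum>j<M. K * R ^ (p + q) / 2 * (X j + Y j))"
    unfolding kern_def by (intro order_trans[OF sum_abs] sum_mono le) auto
  also have "\<dots> = K * R ^ (p + q) / 2 * ((\<Sum>j<M. X j) + (\<Sum>j<M. Y j))"
    by (simp only: sum_distrib_left[symmetric] sum.distrib)
  also have "\<dots> \<le> K * R ^ (p + q) / 2 * (sqrt (2 * pi) * R + sqrt (2 * pi) * R)"
    using K R sums by (intro mult_left_mono add_mono) auto
  finally show ?thesis by (simp add: R_def N_def mult_ac)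
qed

text \<open>Forward differences only look to the right, so a vanishing tail is preserved.\<close>

lemma funpow_fdiff_eq_0:
  assumes "\<And>i. i \<ge> j \<Longrightarrow> a i = 0" "i \<ge> j"
  shows "(fdiff ^^ m) a i = 0"
  using assms(2) by (induction m arbitrary: i) (auto simp: assms(1) fdiff_def)

section \<open>Decay of kernel sums away from the diagonal\<close>

text \<open>Each factor \<open>x - y\<close> costs either an index, which gains a factor \<open>1 / n\<close>, or a difference of the
  coefficients, which gains \<open>1 / n\<^sup>2\<close> at the price of one more index.\<close>

lemma kern_decay:
  fixes F :: "real \<Rightarrow> nat \<Rightarrow> real" and M :: "real \<Rightarrow> nat"
  assumes zero: "\<And>n j. n \<ge> 1 \<Longrightarrow> j \<ge> M n \<Longrightarrow> F n j = 0"
    and diff: "\<And>m. \<exists>K. \<forall>n\<ge>1. \<forall>j. \<bar>(fdiff ^^ m) (F n) j\<bar> \<le> K / n ^ (2 * m)"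
    and M: "\<And>n. n \<ge> 1 \<Longrightarrow> real (M n) \<le> L * n\<^sup>2"
  shows "\<exists>C. \<forall>n\<ge>1. \<forall>x y. n ^ (2 * m + k) * \<bar>sqrt 2 * (x - y)\<bar> ^ k *
           \<bar>kern (M n) p q ((fdiff ^^ m) (F n)) x y\<bar> \<le> C * n ^ (p + q + 1)"
proof (induction k arbitrary: p q m)
  case 0
  obtain K where K: "\<And>n j. n \<ge> 1 \<Longrightarrow> \<bar>(fdiff ^^ m) (F n) j\<bar> \<le> K / n ^ (2 * m)"
    using diff by blast
  \<comment> \<open>Chosen so that \<open>sqrt (M n + p + q) \<le> L' * n\<close> for
    \<open>n \<ge> 1\<close>; the shifts are absorbed into \<open>n\<^sup>2\<close>.\<close>
  define L' where "L' = sqrt (L + real (p + q))"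
  have L: "L \<ge> 0" using M[of 1] by simp
  have K0: "K \<ge> 0" using K[of 1 0] by simp
  have "n ^ (2 * m) * \<bar>kern (M n) p q ((fdiff ^^ m) (F n)) x y\<bar>
      \<le> K * sqrt (2 * pi) * L' ^ (p + q + 1) * n ^ (p + q + 1)" if n: "n \<ge> 1" for n x y
  proof -
    have "real (p + q) \<le> real (p + q) * n\<^sup>2"
      using n by (simp add: mult_le_cancel_left1 one_le_power)
    then have "real (M n + p + q) \<le> (L + real (p + q)) * n\<^sup>2"
      using M[OF n] by (simp add: distrib_right)
    then have "sqrt (real (M n + p + q)) \<le> L' * n"
      using real_sqrt_le_mono n unfolding L'_def by (fastforce simp: real_sqrt_mult)
    then have "sqrt (real (M n + p + q)) ^ (p + q + 1) \<le> (L' * n) ^ (p + q + 1)"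
      by (intro power_mono) auto
    then have "K / n ^ (2 * m) * sqrt (2 * pi) * sqrt (real (M n + p + q)) ^ (p + q + 1)
        \<le> K / n ^ (2 * m) * sqrt (2 * pi) * (L' * n) ^ (p + q + 1)"
      using K0 n by (intro mult_left_mono) auto
    with kern_le[OF K[OF n], where ?M="M n" and ?p=p and ?q=q and ?x=x and ?y=y]
    have "\<bar>kern (M n) p q ((fdiff ^^ m) (F n)) x y\<bar> \<le> K / n ^ (2 * m) * sqrt (2 * pi) * (L' * n) ^ (p + q + 1)"
      by (rule order_trans)
    then have "n ^ (2 * m) * \<bar>kern (M n) p q ((fdiff ^^ m) (F n)) x y\<bar>
        \<le> n ^ (2 * m) * (K / n ^ (2 * m) * sqrt (2 * pi) * (L' * n) ^ (p + q + 1))"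
      using n by (intro mult_left_mono) auto
    also have "\<dots> = K * sqrt (2 * pi) * L' ^ (p + q + 1) * n ^ (p + q + 1)"
      using n by (simp add: power_mult_distrib mult_ac)
    finally show ?thesis .
  qed
  then show ?case by (simp add: exI) blast
next
  case (Suc k)
  \<comment> \<open>The full weight with one factor \<open>\<bar>sqrt 2 * (x - y)\<bar>\<close> held
    back: that factor is expanded by \<open>kern_mult_diff\<close>, and the induction hypothesis for
    \<open>k\<close> treats the four resulting sums.\<close>
  define w where "w n x y = n ^ (2 * m + Suc k) * \<bar>sqrt 2 * (x - y)\<bar> ^ k" for n x y :: real
  have w: "w n x y \<ge> 0" if "n \<ge> 1" for n x y
    using that by (simp add: w_def)
  have T1: "\<exists>C. \<forall>n\<ge>1. \<forall>x y. w n x y * \<bar>real p * kern (M n) (p - 1) q ((fdiff ^^ m) (F n)) x y\<bar> \<le> C * n ^ (p + q + 1)"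
  proof (cases p)
    case 0
    then show ?thesis by (intro exI[of _ 0]) auto
  next
    case (Suc p')
    obtain C where C: "\<And>n x y. n \<ge> 1 \<Longrightarrow> n ^ (2 * m + k) * \<bar>sqrt 2 * (x - y)\<bar> ^ k *
           \<bar>kern (M n) p' q ((fdiff ^^ m) (F n)) x y\<bar> \<le> C * n ^ (p' + q + 1)"
      using Suc.IH by blast
    have "w n x y * \<bar>real p * kern (M n) (p - 1) q ((fdiff ^^ m) (F n)) x y\<bar> \<le> real p * C * n ^ (p + q + 1)" if "n \<ge> 1" for n x y
      \<comment> \<open>The lowered index improves the power on the right by one, which pays for the
        extra \<open>n\<close> in \<open>w\<close>.\<close>
      using mult_left_mono[OF C[OF that, of x y], of "real p * n"] that Suc
      by (simp add: w_def abs_mult mult_ac)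
    then show ?thesis by blast
  qed
  have T2: "\<exists>C. \<forall>n\<ge>1. \<forall>x y. w n x y * \<bar>real q * kern (M n) p (q - 1) ((fdiff ^^ m) (F n)) x y\<bar> \<le> C * n ^ (p + q + 1)"
  proof (cases q)
    case 0
    then show ?thesis by (intro exI[of _ 0]) auto
  next
    case (Suc q')
    obtain C where C: "\<And>n x y. n \<ge> 1 \<Longrightarrow> n ^ (2 * m + k) * \<bar>sqrt 2 * (x - y)\<bar> ^ k *
           \<bar>kern (M n) p q' ((fdiff ^^ m) (F n)) x y\<bar> \<le> C * n ^ (p + q' + 1)"
      using Suc.IH by blast
    have "w n x y * \<bar>real q * kern (M n) p (q - 1) ((fdiff ^^ m) (F n)) x y\<bar> \<le> real q * C * n ^ (p + q + 1)" if "n \<ge> 1" for n x y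
      using mult_left_mono[OF C[OF that, of x y], of "real q * n"] that Suc
      by (simp add: w_def abs_mult mult_ac)
    then show ?thesis by blast
  qed
  have T3: "\<exists>C. \<forall>n\<ge>1. \<forall>x y. w n x y * \<bar>kern (M n) r s (fdiff ((fdiff ^^ m) (F n))) x y\<bar> \<le> C * n ^ (p + q + 1)"
    if rs: "r + s = Suc (p + q)" for r s
  proof -
    obtain C where C: "\<And>n x y. n \<ge> 1 \<Longrightarrow> n ^ (2 * Suc m + k) * \<bar>sqrt 2 * (x - y)\<bar> ^ k *
           \<bar>kern (M n) r s ((fdiff ^^ Suc m) (F n)) x y\<bar> \<le> C * n ^ (r + s + 1)"
      using Suc.IH by blast
    have "w n x y * \<bar>kern (M n) r s (fdiff ((fdiff ^^ m) (F n))) x y\<bar> \<le> C * n ^ (p + q + 1)" if n: "n \<ge> 1" for n x y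
    proof -
      \<comment> \<open>With \<open>m\<close> raised to \<open>Suc m\<close>, the hypothesis carries
        one more \<open>n\<close> than \<open>w\<close> on the left; the raised index costs one more
        on the right, and the two cancel.\<close>
      have "n * (w n x y * \<bar>kern (M n) r s (fdiff ((fdiff ^^ m) (F n))) x y\<bar>) \<le> n * (C * n ^ (p + q + 1))"
        using C[OF n, of x y] by (simp add: w_def rs mult_ac)
      then show ?thesis using n by (simp only: mult_le_cancel_left_pos)
    qed
    then show ?thesis by blast
  qed
  obtain C1 where C1: "\<And>n x y. n \<ge> 1 \<Longrightarrow> w n x y * \<bar>real p * kern (M n) (p - 1) q ((fdiff ^^ m) (F n)) x y\<bar> \<le> C1 * n ^ (p + q + 1)"
    using T1 by blast
  obtain C2 where C2: "\<And>n x y. n \<ge> 1 \<Longrightarrow> w n x y * \<bar>real q * kern (M n) p (q - 1) ((fdiff ^^ m) (F n)) x y\<bar> \<le> C2 * n ^ (p + q + 1)"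
    using T2 by blast
  obtain C3 where C3: "\<And>n x y. n \<ge> 1 \<Longrightarrow> w n x y * \<bar>kern (M n) p (Suc q) (fdiff ((fdiff ^^ m) (F n))) x y\<bar> \<le> C3 * n ^ (p + q + 1)"
    using T3[of p "Suc q"] by auto
  obtain C4 where C4: "\<And>n x y. n \<ge> 1 \<Longrightarrow> w n x y * \<bar>kern (M n) (Suc p) q (fdiff ((fdiff ^^ m) (F n))) x y\<bar> \<le> C4 * n ^ (p + q + 1)"
    using T3[of "Suc p" q] by auto
  have "n ^ (2 * m + Suc k) * \<bar>sqrt 2 * (x - y)\<bar> ^ Suc k * \<bar>kern (M n) p q ((fdiff ^^ m) (F n)) x y\<bar>
      \<le> (C1 + C3 + C4 + C2) * n ^ (p + q + 1)" if n: "n \<ge> 1" for n x y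
  proof -
    have "(fdiff ^^ m) (F n) (M n) = 0"
      by (rule funpow_fdiff_eq_0[of "M n"]) (use zero n in auto)
    from kern_mult_diff[of "(fdiff ^^ m) (F n)", OF this, of x y p q]
    have "\<bar>sqrt 2 * (x - y) * kern (M n) p q ((fdiff ^^ m) (F n)) x y\<bar>
      \<le> \<bar>real p * kern (M n) (p - 1) q ((fdiff ^^ m) (F n)) x y\<bar>
       + \<bar>kern (M n) p (Suc q) (fdiff ((fdiff ^^ m) (F n))) x y\<bar>
       + \<bar>kern (M n) (Suc p) q (fdiff ((fdiff ^^ m) (F n))) x y\<bar>
       + \<bar>real q * kern (M n) p (q - 1) ((fdiff ^^ m) (F n)) x y\<bar>"
      by linarith
    from mult_left_mono[OF this w[OF n, of x y]]
    have "w n x y * \<bar>sqrt 2 * (x - y) * kern (M n) p q ((fdiff ^^ m) (F n)) x y\<bar>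
      \<le> (C1 + C3 + C4 + C2) * n ^ (p + q + 1)"
      using C1[OF n, of x y] C2[OF n, of x y] C3[OF n, of x y] C4[OF n, of x y]
      by (simp only: distrib_left distrib_right)
    then show ?thesis by (simp add: w_def abs_mult mult_ac)
  qed
  then show ?case by blast
qed

section \<open>Smoothness of \<open>t \<mapsto> H (sqrt t)\<close> up to zero\<close>

lemma smooth_has_derivative:
  "smooth f \<Longrightarrow> ((deriv ^^ k) f has_field_derivative (deriv ^^ Suc k) f x) (at x)"
  by (simp add: smooth_def DERIV_deriv_iff_field_differentiable)

lemma smooth_continuous: "smooth f \<Longrightarrow> continuous_on A ((deriv ^^ k) f)"
  by (meson DERIV_isCont continuous_at_imp_continuous_on smooth_has_derivative)

text \<open>The Hadamard-type remainder integral for dividing by \<open>s\<close>. The power of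
  \<open>u\<close> makes the family closed under differentiation, since each derivative in
  \<open>s\<close> produces a factor \<open>u\<close>.\<close>

definition moment :: "nat \<Rightarrow> (real \<Rightarrow> real) \<Rightarrow> real \<Rightarrow> real" where
  "moment k f s = integral {0..1} (\<lambda>u. u ^ k * f (u * s))"

lemma has_derivative_moment:
  assumes "smooth f"
  shows "(moment k ((deriv ^^ m) f) has_field_derivative moment (Suc k) ((deriv ^^ Suc m) f) s) (at s)"
proof -
  define g g' where "g = (deriv ^^ m) f" and "g' = (deriv ^^ Suc m) f"
  have g: "(g has_field_derivative g' x) (at x)" for x
    unfolding g_def g'_def by (rule smooth_has_derivative[OF assms])
  have cont: "continuous_on A g" "continuous_on A g'" for A
    unfolding g_def g'_def by (rule smooth_continuous[OF assms])+
  have "((\<lambda>s. integral (cbox 0 1) (\<lambda>u. u ^ k * g (u * s))) has_field_derivative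
      integral (cbox 0 1) (\<lambda>u. u ^ Suc k * g' (u * s))) (at s within UNIV)"
  proof (rule leibniz_rule_field_derivative)
    show "((\<lambda>x. t ^ k * g (t * x)) has_field_derivative t ^ Suc k * g' (t * x)) (at x within UNIV)" for x t :: real
      by (rule derivative_eq_intros DERIV_chain2[OF g] refl | simp)+
    show "(\<lambda>u. u ^ k * g (u * x)) integrable_on cbox 0 1" for x
      by (intro integrable_continuous continuous_intros continuous_on_compose2[OF cont(1)]) auto
    show "continuous_on (UNIV \<times> cbox 0 1) (\<lambda>(x, t). t ^ Suc k * g' (t * x))"
      unfolding case_prod_beta
      by (intro continuous_intros continuous_on_compose2[OF cont(2)]) auto
  qed auto
  moreover have "moment k g = (\<lambda>s. integral (cbox 0 1) (\<lambda>u. u ^ k * g (u * s)))"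
    by (simp add: fun_eq_iff moment_def)
  ultimately show ?thesis
    by (simp add: moment_def g_def g'_def)
qed

lemma deriv_funpow_moment:
  assumes "smooth f"
  shows "(deriv ^^ m) (moment k f) = moment (k + m) ((deriv ^^ m) f)"
proof (induction m)
  case (Suc m)
  show ?case
    using DERIV_imp_deriv[OF has_derivative_moment[OF assms, of "k + m" m]] by (simp add: Suc fun_eq_iff)
qed simp

lemma smooth_moment:
  assumes "smooth f"
  shows "smooth (moment k f)"
  unfolding smooth_def deriv_funpow_moment[OF assms] field_differentiable_def
  using has_derivative_moment[OF assms] by blast

lemma smooth_deriv_funpow: "smooth f \<Longrightarrow> smooth ((deriv ^^ m) f)"
  unfolding smooth_def by (metis funpow_add comp_apply)

lemma funpow_deriv_scale:
  assumes "smooth f"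
  shows "(deriv ^^ m) (\<lambda>x. c * f x) = (\<lambda>x. c * (deriv ^^ m) f x)"
proof (induction m)
  case (Suc m)
  show ?case
    using DERIV_imp_deriv[OF DERIV_cmult[OF smooth_has_derivative[OF assms]], of c m]
    by (intro ext) (simp add: Suc)
qed simp

lemma smooth_scale:
  assumes "smooth f"
  shows "smooth (\<lambda>x. c * f x)"
  unfolding smooth_def funpow_deriv_scale[OF assms] field_differentiable_def
  using DERIV_cmult[OF smooth_has_derivative[OF assms]] by blast

lemma deriv_even:
  assumes "smooth f" "\<And>t. f (- t) = f t"
  shows "deriv f (- t) = - deriv f t"
proof -
  have "((\<lambda>t. f (- t)) has_field_derivative - deriv f (- t)) (at t)"
    using DERIV_chain2[OF smooth_has_derivative[OF assms(1), of 0 "- t"] DERIV_minus[OF DERIV_ident]] by simp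
  then show ?thesis
    using DERIV_imp_deriv assms(2) by fastforce
qed

lemma deriv_odd:
  assumes "smooth f" "\<And>t. f (- t) = - f t"
  shows "deriv f (- t) = deriv f t"
proof -
  have "((\<lambda>t. - f (- t)) has_field_derivative - (- deriv f (- t))) (at t)"
    using DERIV_minus[OF DERIV_chain2[OF smooth_has_derivative[OF assms(1), of 0 "- t"] DERIV_minus[OF DERIV_ident]]] by simp
  then show ?thesis
    using DERIV_imp_deriv assms(2) by fastforce
qed

text \<open>The derivative of an even function is odd, hence zero at \<open>0\<close>, so it equals
  \<open>s\<close> times the integral of \<open>deriv (deriv f) (u * s)\<close> over
  \<open>u\<close> in \<open>[0, 1]\<close>. The factor \<open>2 * s\<close> is chosen so that
  \<open>g (sqrt t)\<close> is the derivative of \<open>f (sqrt t)\<close> for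
  \<open>t > 0\<close>.\<close>

lemma smooth_even_divide:
  assumes f: "smooth f" and even: "\<And>t. f (- t) = f t"
  shows "\<exists>g. smooth g \<and> (\<forall>t. g (- t) = g t) \<and> (\<forall>s. deriv f s = 2 * s * g s)"
proof (intro exI conjI allI)
  let ?g = "\<lambda>s. 1 / 2 * moment 0 (deriv (deriv f)) s"
  have f2: "smooth (deriv (deriv f))"
    using smooth_deriv_funpow[OF f, of 2] by (simp add: numeral_2_eq_2)
  show "smooth ?g"
    by (intro smooth_scale smooth_moment f2)
  have odd: "deriv f (- t) = - deriv f t" for t
    by (rule deriv_even[OF f even])
  have f1: "smooth (deriv f)"
    using smooth_deriv_funpow[OF f, of 1] by simp
  show "?g (- t) = ?g t" for t
    by (simp add: moment_def deriv_odd[OF f1 odd])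
  show "deriv f s = 2 * s * ?g s" for s
  proof -
    have I: "((\<lambda>u. s * deriv (deriv f) (u * s)) has_integral deriv f (1 * s) - deriv f (0 * s)) {0..1}"
    proof (rule fundamental_theorem_of_calculus)
      fix u :: real
      have "((\<lambda>u. deriv f (u * s)) has_field_derivative deriv (deriv f) (u * s) * s) (at u within {0..1})"
        by (rule DERIV_chain2[OF smooth_has_derivative[OF f1, of 0, simplified]])
          (auto intro!: derivative_eq_intros)
      then show "((\<lambda>u. deriv f (u * s)) has_vector_derivative s * deriv (deriv f) (u * s)) (at u within {0..1})"
        by (simp add: has_real_derivative_iff_has_vector_derivative mult.commute)
    qed simp
    have "deriv f 0 = 0" using odd[of 0] by simp
    then show ?thesis
      using integral_unique[OF I] by (simp add: moment_def)
  qed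
qed

text \<open>\<open>G k\<close> is the \<open>k\<close>-th derivative of \<open>H (sqrt t)\<close>,
  extended continuously to \<open>0\<close>. Evenness passes from each quotient to the next, so the
  division can be repeated forever.\<close>

lemma smooth_even_sqrt_chain:
  assumes "smooth H" "\<And>t. H (- t) = H t"
  obtains G :: "nat \<Rightarrow> real \<Rightarrow> real" where "\<And>t. G 0 t = H (sqrt t)"
    "\<And>k. continuous_on {0..} (G k)"
    "\<And>k t. t > 0 \<Longrightarrow> (G k has_field_derivative G (Suc k) t) (at t)"
proof -
  \<comment> \<open>The clause for \<open>k = 0\<close> pins the chosen sequence to start at
    \<open>H\<close>.\<close>
  define P where "P k g \<longleftrightarrow> smooth g \<and> (\<forall>t. g (- t) = g t) \<and> (k = 0 \<longrightarrow> g = H)"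
    for k :: nat and g
  have "\<exists>g. \<forall>k. P k (g k) \<and> (\<forall>s. deriv (g k) s = 2 * s * g (Suc k) s)"
  proof (rule dependent_nat_choice)
    show "\<exists>g. P 0 g" unfolding P_def using assms by (intro exI[of _ H]) auto
  next
    fix k g assume "P k g"
    then obtain g' where "smooth g'" "\<forall>t. g' (- t) = g' t" "\<forall>s. deriv g s = 2 * s * g' s"
      unfolding P_def by (metis smooth_even_divide)
    then show "\<exists>g'. P (Suc k) g' \<and> (\<forall>s. deriv g s = 2 * s * g' s)"
      unfolding P_def by (intro exI[of _ g']) auto
  qed
  then obtain g where P: "\<And>k. P k (g k)" and dg: "\<And>k s. deriv (g k) s = 2 * s * g (Suc k) s"
    by blast
  have g0: "g 0 = H" and sg: "smooth (g k)" for k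
    using P[of 0] P[of k] unfolding P_def by simp_all
  show thesis
  proof
    show "g 0 (sqrt t) = H (sqrt t)" for t by (simp only: g0)
    show "continuous_on {0..} (\<lambda>t. g k (sqrt t))" for k
      by (intro continuous_on_compose2[OF smooth_continuous[OF sg, of UNIV 0, simplified]] continuous_intros) auto
    show "((\<lambda>t. g k (sqrt t)) has_field_derivative g (Suc k) (sqrt t)) (at t)" if "t > 0" for k t
    proof -
      have "(g k has_field_derivative 2 * sqrt t * g (Suc k) (sqrt t)) (at (sqrt t))"
        using smooth_has_derivative[OF sg[of k], of 0 "sqrt t"] by (simp add: dg)
      from DERIV_chain2[OF this DERIV_real_sqrt[OF that]] show ?thesis
        using that by (simp add: inverse_eq_divide)
    qed
  qed
qed

text \<open>Induction on \<open>m\<close> applied to the chain of increments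
  \<open>f k (t + h) - f k t\<close>: one mean value step turns the bound on
  \<open>f (Suc m)\<close> into the bound \<open>K * h\<close> on the \<open>m\<close>-th
  increment.\<close>

lemma funpow_fdiff_sample_le:
  fixes f :: "nat \<Rightarrow> real \<Rightarrow> real"
  assumes "h > 0"
    and "\<And>k. continuous_on {0..} (f k)"
    and "\<And>k t. t > 0 \<Longrightarrow> (f k has_field_derivative f (Suc k) t) (at t)"
    and "\<And>t. 0 \<le> t \<Longrightarrow> t \<le> real (j + m) * h \<Longrightarrow> \<bar>f m t\<bar> \<le> K"
  shows "\<bar>(fdiff ^^ m) (\<lambda>i. f 0 (real i * h)) j\<bar> \<le> K * h ^ m"
  using assms(2-)
proof (induction m arbitrary: f K)
  case 0
  then show ?case using assms(1) by simp
next
  case (Suc m)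
  define f' where "f' k t = f k (t + h) - f k t" for k t
  have "\<bar>(fdiff ^^ m) (\<lambda>i. f' 0 (real i * h)) j\<bar> \<le> (K * h) * h ^ m"
  proof (rule Suc.IH)
    show "continuous_on {0..} (f' k)" for k
      unfolding f'_def using assms(1)
      by (intro continuous_intros Suc.prems continuous_on_compose2[OF Suc.prems(1)]) auto
    show "(f' k has_field_derivative f' (Suc k) t) (at t)" if "t > 0" for k t
    proof -
      have "((\<lambda>t. f k (t + h)) has_field_derivative f (Suc k) (t + h)) (at t)"
        using that assms(1) by (intro iffD1[OF DERIV_shift] Suc.prems(2)) auto
      then show ?thesis
        unfolding f'_def by (intro DERIV_diff Suc.prems(2) that)
    qed
    show "\<bar>f' m t\<bar> \<le> K * h" if t: "0 \<le> t" "t \<le> real (j + m) * h" for t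
    proof -
      have dm: "(f m has_field_derivative f (Suc m) x) (at x)" if "t < x" for x
        using t that by (intro Suc.prems(2)) simp
      \<comment> \<open>The left endpoint may be \<open>0\<close>, where only continuity is
        available; the mean value theorem uses derivatives in the interior alone.\<close>
      have "\<exists>l z. t < z \<and> z < t + h \<and> DERIV (f m) z :> l \<and> f m (t + h) - f m t = (t + h - t) * l"
        using assms(1) t dm
        by (intro MVT continuous_on_subset[OF Suc.prems(1)]) (auto simp: real_differentiable_def)
      then obtain l z where z: "t < z" "z < t + h" "DERIV (f m) z :> l" "f m (t + h) - f m t = h * l"
        by auto
      then have "l = f (Suc m) z"
        using dm DERIV_unique by blast
      moreover have "z \<le> real (j + Suc m) * h"
        using z(2) t(2) by (simp add: algebra_simps)
      ultimately have "\<bar>l\<bar> \<le> K"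
        using Suc.prems(3)[of z] t z by simp
      then show ?thesis
        using assms(1) by (simp add: f'_def z(4) abs_mult mult.commute)
    qed
  qed
  moreover have "fdiff (\<lambda>i. f 0 (real i * h)) = (\<lambda>i. f' 0 (real i * h))"
    by (simp add: fun_eq_iff fdiff_def f'_def algebra_simps)
  ultimately show ?case
    by (simp add: funpow_Suc_right mult_ac del: funpow.simps)
qed

section \<open>From integer powers to the weight with real exponent \<open>S\<close>\<close>

lemma max_one_powr_le:
  fixes t S :: real
  assumes "t \<ge> 0" "S \<ge> 0" "S \<le> real k"
  shows "max 1 (t powr S) \<le> 1 + t ^ k"
proof (cases "t \<le> 1")
  case True
  then have "t powr S \<le> 1"
    using assms powr_mono2[of S t 1] by simp
  then show ?thesis using assms by simp
next
  case False
  then have "t powr S \<le> t powr real k"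
    using assms by (intro powr_mono) auto
  also have "\<dots> = t ^ k"
    using False by (intro powr_realpow) auto
  finally show ?thesis using assms by auto
qed

text \<open>The bound without decay and the bound of order \<open>k\<close> are added, since
  together their weights dominate the maximum.\<close>

lemma le_divide_max_powr:
  fixes z n d b S C0 C1 c :: real
  assumes "n \<ge> 1" "d \<ge> 0" "S \<ge> 0" "S \<le> real k" "b \<ge> 0"
    and "\<bar>z\<bar> \<le> C0 * b" "n ^ k * d ^ k * \<bar>z\<bar> \<le> C1 * b" "C0 + C1 \<le> c"
  shows "\<bar>z\<bar> \<le> c * (b / max 1 ((n * d) powr S))"
proof -
  have "\<bar>z\<bar> * max 1 ((n * d) powr S) \<le> \<bar>z\<bar> * (1 + (n * d) ^ k)"
    using assms by (intro mult_left_mono max_one_powr_le) auto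
  also have "\<dots> \<le> (C0 + C1) * b"
    using assms(6,7) by (simp add: algebra_simps power_mult_distrib)
  also have "\<dots> \<le> c * b"
    using assms by (intro mult_right_mono) auto
  finally show ?thesis
    by (simp add: pos_le_divide_eq less_max_iff_disj)
qed

lemma compactly_supported_bound:
  assumes "compactly_supported H"
  obtains A where "A > 0" "\<And>t. t \<ge> A \<Longrightarrow> H t = 0"
proof -
  have "bounded (support_on UNIV H)"
    using assms bounded_subset[OF compact_imp_bounded closure_subset]
    unfolding compactly_supported_def by simp
  then obtain B where B: "\<And>x. H x \<noteq> 0 \<Longrightarrow> \<bar>x\<bar> \<le> B"
    by (auto simp: bounded_iff support_on_def)
  show thesis
    \<comment> \<open>The added one gives positivity and places \<open>A\<close> strictly beyond the
      support.\<close>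
    by (rule that[of "\<bar>B\<bar> + 1"]) (use B in force)+
qed

section \<open>Coefficients sampled from \<open>H\<close>, and decay of \<open>Phi\<close>\<close>

locale hermite_kernel =
  fixes H :: "real \<Rightarrow> real" and A :: real
  assumes smooth_H: "smooth H" and even_H: "H (- t) = H t"
    and A_pos: "A > 0" and H_eq_0: "t \<ge> A \<Longrightarrow> H t = 0"
begin

definition F :: "real \<Rightarrow> nat \<Rightarrow> real" where
  "F n j = H (sqrt (real j) / n)"

definition M :: "real \<Rightarrow> nat" where
  "M n = nat \<lceil>A\<^sup>2 * n\<^sup>2\<rceil>"

lemma F_eq_0:
  assumes "n > 0" "A\<^sup>2 * n\<^sup>2 \<le> real j"
  shows "F n j = 0"
proof -
  have "A * n \<le> sqrt (real j)"
    using assms by (intro real_le_rsqrt) (simp add: power_mult_distrib)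
  then show ?thesis
    unfolding F_def using assms(1) by (intro H_eq_0) (simp add: field_simps)
qed

lemma F_eq_0': "n \<ge> 1 \<Longrightarrow> j \<ge> M n \<Longrightarrow> F n j = 0"
  by (intro F_eq_0) (auto simp: M_def nat_le_iff ceiling_le_iff)

lemma M_le:
  assumes "n \<ge> 1"
  shows "real (M n) \<le> (A\<^sup>2 + 1) * n\<^sup>2"
proof -
  have "0 \<le> A\<^sup>2 * n\<^sup>2" by simp
  then have "0 \<le> \<lceil>A\<^sup>2 * n\<^sup>2\<rceil>" by linarith
  then have "real (M n) \<le> A\<^sup>2 * n\<^sup>2 + 1"
    unfolding M_def using of_int_ceiling_le_add_one[of "A\<^sup>2 * n\<^sup>2"] by simp
  also have "\<dots> \<le> (A\<^sup>2 + 1) * n\<^sup>2"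
    using assms by (simp add: distrib_right one_le_power)
  finally show ?thesis .
qed

text \<open>\<open>F n\<close> samples \<open>H (sqrt t)\<close> at step
  \<open>1 / n\<^sup>2\<close>, so \<open>m\<close> differences gain
  \<open>1 / n ^ (2 * m)\<close>.\<close>

lemma funpow_fdiff_F_le: "\<exists>K. \<forall>n\<ge>1. \<forall>j. \<bar>(fdiff ^^ m) (F n) j\<bar> \<le> K / n ^ (2 * m)"
proof -
  obtain G :: "nat \<Rightarrow> real \<Rightarrow> real" where G0: "\<And>t. G 0 t = H (sqrt t)"
    and Gc: "\<And>k. continuous_on {0..} (G k)"
    and Gd: "\<And>k t. t > 0 \<Longrightarrow> (G k has_field_derivative G (Suc k) t) (at t)"
    using smooth_even_sqrt_chain[OF smooth_H even_H] by blast
  \<comment> \<open>For \<open>j < A\<^sup>2 * n\<^sup>2\<close> the \<open>m\<close>-th difference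
    samples points up to \<open>(j + m) / n\<^sup>2\<close>, which is at most
    \<open>A\<^sup>2 + m\<close>; for larger \<open>j\<close> it is zero. Hence \<open>K\<close> is
    independent of \<open>n\<close> and \<open>j\<close>.\<close>
  have "compact (G m ` {0..A\<^sup>2 + real m})"
    by (intro compact_continuous_image continuous_on_subset[OF Gc]) auto
  then obtain K where K: "\<And>t. 0 \<le> t \<Longrightarrow> t \<le> A\<^sup>2 + real m \<Longrightarrow> \<bar>G m t\<bar> \<le> K"
    by (fastforce dest!: compact_imp_bounded simp: bounded_iff)
  have K0: "K \<ge> 0" using K[of 0] by simp
  have "\<bar>(fdiff ^^ m) (F n) j\<bar> \<le> K / n ^ (2 * m)" if n: "n \<ge> 1" for n j
  proof (cases "A\<^sup>2 * n\<^sup>2 \<le> real j")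
    case True
    have "(fdiff ^^ m) (F n) j = 0"
      by (rule funpow_fdiff_eq_0[of j]) (use True n in \<open>auto intro!: F_eq_0\<close>)
    then show ?thesis using K0 n by simp
  next
    case False
    define h where "h = 1 / n\<^sup>2"
    have h: "h > 0" "h \<le> 1" using n by (auto simp: h_def one_le_power)
    have "real j * h \<le> A\<^sup>2"
      using False n by (simp add: h_def field_simps)
    moreover have "real m * h \<le> real m"
      using h by (simp add: mult_left_le)
    ultimately have "real (j + m) * h \<le> A\<^sup>2 + real m"
      by (simp add: distrib_right)
    then have "\<bar>(fdiff ^^ m) (\<lambda>i. G 0 (real i * h)) j\<bar> \<le> K * h ^ m"
      by (intro funpow_fdiff_sample_le h Gc Gd K) auto
    moreover have "(\<lambda>i. G 0 (real i * h)) = F n"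
      using n by (simp add: fun_eq_iff G0 F_def h_def real_sqrt_divide)
    ultimately show ?thesis
      by (simp add: h_def power_mult power_divide)
  qed
  then show ?thesis by blast
qed

lemma kern_F_decay:
  "\<exists>C. \<forall>n\<ge>1. \<forall>x y. n ^ k * \<bar>x - y\<bar> ^ k * \<bar>kern (M n) p q ((fdiff ^^ m) (F n)) x y\<bar> \<le> C * n ^ (p + q + 1)"
proof -
  obtain C where C: "\<And>n x y. n \<ge> 1 \<Longrightarrow> n ^ (2 * m + k) * \<bar>sqrt 2 * (x - y)\<bar> ^ k *
       \<bar>kern (M n) p q ((fdiff ^^ m) (F n)) x y\<bar> \<le> C * n ^ (p + q + 1)"
    using kern_decay[of M F "A\<^sup>2 + 1" m k p q] F_eq_0' funpow_fdiff_F_le M_le by blast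
  have "n ^ k * \<bar>x - y\<bar> ^ k * \<bar>kern (M n) p q ((fdiff ^^ m) (F n)) x y\<bar> \<le> C * n ^ (p + q + 1)"
    if n: "n \<ge> 1" for n x y
  proof -
    have "\<bar>x - y\<bar> \<le> \<bar>sqrt 2 * (x - y)\<bar>"
      by (simp add: abs_mult mult_le_cancel_right1)
    then have "n ^ k * \<bar>x - y\<bar> ^ k \<le> n ^ (2 * m + k) * \<bar>sqrt 2 * (x - y)\<bar> ^ k"
      using n by (intro mult_mono power_mono power_increasing) auto
    then show ?thesis
      using C[OF n, of x y] by (meson abs_ge_zero mult_right_mono order_trans)
  qed
  then show ?thesis by blast
qed

lemma Phi_eq_kern:
  assumes "n \<ge> 1"
  shows "Phi n H x y = kern (M n) 0 0 (F n) x y"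
proof -
  have "Phi n H x y = (\<Sum>j<M n. H (sqrt (real j) / n) * hermite_fun j x * hermite_fun j y)"
    unfolding Phi_def using F_eq_0'[OF assms]
    by (intro suminf_finite) (auto simp: F_def)
  also have "\<dots> = kern (M n) 0 0 (F n) x y"
    by (simp add: kern_def F_def hermite_fun_eq mult.assoc del: herm.simps)
  finally show ?thesis .
qed

text \<open>Differentiation lowers or raises the index in \<open>x\<close>. Reindexing the lowered
  part gives coefficients \<open>F n (Suc j)\<close>, which split into \<open>F n\<close> and its
  difference; every sum then has total shift one, which accounts for \<open>n\<^sup>2\<close> in
  place of \<open>n\<close>.\<close>

lemma deriv_Phi_eq_kern:
  assumes "n \<ge> 1"
  shows "deriv (\<lambda>t. Phi n H t y) x =
    (kern (M n) 0 1 (F n) x y + kern (M n) 0 1 (fdiff (F n)) x y - kern (M n) 1 0 (F n) x y) / sqrt 2"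
proof -
  have "((\<lambda>t. kern (M n) 0 0 (F n) t y) has_field_derivative
     (\<Sum>j<M n. F n j * ((real j * herm (j - 1) x - herm (Suc j) x) / sqrt 2 * herm j y / fact j))) (at x)"
    unfolding kern_def
    by (rule derivative_eq_intros has_derivative_herm refl | simp add: mult_ac del: herm.simps)+
  also have "(\<Sum>j<M n. F n j * ((real j * herm (j - 1) x - herm (Suc j) x) / sqrt 2 * herm j y / fact j))
    = ((\<Sum>j<M n. F n j * (real j * (herm (j - 1) x * herm j y) / fact j)) - kern (M n) 1 0 (F n) x y) / sqrt 2"
    by (simp add: kern_def sum_divide_distrib sum_subtractf[symmetric] diff_divide_distrib algebra_simps
        del: herm.simps)
  also have "(\<Sum>j<M n. F n j * (real j * (herm (j - 1) x * herm j y) / fact j))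
    = kern (M n) 0 1 (\<lambda>j. F n (Suc j)) x y"
    using sum_fact_shift[of "F n" "M n" "\<lambda>j. herm (j - 1) x * herm j y"] F_eq_0'[OF assms, of "M n"]
    by (simp add: kern_def del: herm.simps)
  also have "\<dots> = kern (M n) 0 1 (F n) x y + kern (M n) 0 1 (fdiff (F n)) x y"
    by (simp add: kern_fdiff)
  finally show ?thesis
    by (simp add: Phi_eq_kern[OF assms] DERIV_imp_deriv)
qed

lemma Phi_decay: "\<exists>C. \<forall>n\<ge>1. \<forall>x y. n ^ k * \<bar>x - y\<bar> ^ k * \<bar>Phi n H x y\<bar> \<le> C * n"
  using kern_F_decay[of k 0 0 0] by (simp add: Phi_eq_kern)

lemma deriv_Phi_decay:
  "\<exists>C. \<forall>n\<ge>1. \<forall>x y. n ^ k * \<bar>x - y\<bar> ^ k * \<bar>deriv (\<lambda>t. Phi n H t y) x\<bar> \<le> C * n\<^sup>2"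
proof -
  obtain C1 where C1: "\<And>n x y. n \<ge> 1 \<Longrightarrow> n ^ k * \<bar>x - y\<bar> ^ k * \<bar>kern (M n) 0 1 (F n) x y\<bar> \<le> C1 * n\<^sup>2"
    using kern_F_decay[of k 0 1 0] by (auto simp: numeral_2_eq_2)
  obtain C2 where C2: "\<And>n x y. n \<ge> 1 \<Longrightarrow> n ^ k * \<bar>x - y\<bar> ^ k * \<bar>kern (M n) 0 1 (fdiff (F n)) x y\<bar> \<le> C2 * n\<^sup>2"
    using kern_F_decay[of k 0 1 1] by (auto simp: numeral_2_eq_2)
  obtain C3 where C3: "\<And>n x y. n \<ge> 1 \<Longrightarrow> n ^ k * \<bar>x - y\<bar> ^ k * \<bar>kern (M n) 1 0 (F n) x y\<bar> \<le> C3 * n\<^sup>2"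
    using kern_F_decay[of k 1 0 0] by (auto simp: numeral_2_eq_2)
  have "n ^ k * \<bar>x - y\<bar> ^ k * \<bar>deriv (\<lambda>t. Phi n H t y) x\<bar> \<le> (C1 + C2 + C3) * n\<^sup>2" if n: "n \<ge> 1" for n x y
  proof -
    have sqrt2: "\<bar>z / sqrt 2\<bar> \<le> \<bar>z\<bar>" for z :: real
      by (simp add: field_simps mult_le_cancel_left1)
    have "\<bar>deriv (\<lambda>t. Phi n H t y) x\<bar>
      \<le> \<bar>kern (M n) 0 1 (F n) x y\<bar> + \<bar>kern (M n) 0 1 (fdiff (F n)) x y\<bar> + \<bar>kern (M n) 1 0 (F n) x y\<bar>"
      unfolding deriv_Phi_eq_kern[OF n] by (rule order_trans[OF sqrt2]) linarith
    then have "n ^ k * \<bar>x - y\<bar> ^ k * \<bar>deriv (\<lambda>t. Phi n H t y) x\<bar> \<le> n ^ k * \<bar>x - y\<bar> ^ k *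
      (\<bar>kern (M n) 0 1 (F n) x y\<bar> + \<bar>kern (M n) 0 1 (fdiff (F n)) x y\<bar> + \<bar>kern (M n) 1 0 (F n) x y\<bar>)"
      using n by (intro mult_left_mono) auto
    then show ?thesis
      using C1[OF n, of x y] C2[OF n, of x y] C3[OF n, of x y]
      by (simp only: distrib_left distrib_right)
  qed
  then show ?thesis by blast
qed

end

theorem theorem3:
  fixes H :: "real \<Rightarrow> real" and S :: real
  assumes "compactly_supported H"
    and "smooth H"
    and "\<And>t. H (- t) = H t"
    and "S \<ge> 3"
  shows "\<exists>c>0. \<forall>x y n :: real. n \<ge> 1 \<longrightarrow>
           \<bar>Phi n H x y\<bar> \<le> c * (n / max 1 ((n * \<bar>x - y\<bar>) powr S)) \<and>
           \<bar>deriv (\<lambda>t. Phi n H t y) x\<bar> \<le> c * (n\<^sup>2 / max 1 ((n * \<bar>x - y\<bar>) powr S))"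
proof -
  obtain A where A: "A > 0" "\<And>t. t \<ge> A \<Longrightarrow> H t = 0"
    using compactly_supported_bound[OF assms(1)] by blast
  interpret hermite_kernel H A
    using assms A by unfold_locales auto
  \<comment> \<open>Decay is available for integer orders only, so \<open>S\<close> is rounded
    up.\<close>
  define k where "k = nat \<lceil>S\<rceil>"
  have k: "S \<le> real k" unfolding k_def by linarith
  obtain C0 C1 D0 D1 where
    C0: "\<And>n x y. n \<ge> 1 \<Longrightarrow> n ^ 0 * \<bar>x - y\<bar> ^ 0 * \<bar>Phi n H x y\<bar> \<le> C0 * n" and
    C1: "\<And>n x y. n \<ge> 1 \<Longrightarrow> n ^ k * \<bar>x - y\<bar> ^ k * \<bar>Phi n H x y\<bar> \<le> C1 * n" and
    D0: "\<And>n x y. n \<ge> 1 \<Longrightarrow> n ^ 0 * \<bar>x - y\<bar> ^ 0 * \<bar>deriv (\<lambda>t. Phi n H t y) x\<bar> \<le> D0 * n\<^sup>2" and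
    D1: "\<And>n x y. n \<ge> 1 \<Longrightarrow> n ^ k * \<bar>x - y\<bar> ^ k * \<bar>deriv (\<lambda>t. Phi n H t y) x\<bar> \<le> D1 * n\<^sup>2"
    using Phi_decay[of 0] Phi_decay[of k] deriv_Phi_decay[of 0] deriv_Phi_decay[of k] by metis
  \<comment> \<open>One constant serves both estimates; the outer \<open>1\<close> ensures
    positivity.\<close>
  define c where "c = max 1 (max (C0 + C1) (D0 + D1))"
  have "\<bar>Phi n H x y\<bar> \<le> c * (n / max 1 ((n * \<bar>x - y\<bar>) powr S))" if n: "n \<ge> 1" for n x y
    using n assms(4) k C0[OF n, of x y] C1[OF n, of x y]
    by (intro le_divide_max_powr[of n _ S k _ _ C0 C1]) (auto simp: c_def)
  moreover have "\<bar>deriv (\<lambda>t. Phi n H t y) x\<bar> \<le> c * (n\<^sup>2 / max 1 ((n * \<bar>x - y\<bar>) powr S))"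
    if n: "n \<ge> 1" for n x y
    using n assms(4) k D0[OF n, of x y] D1[OF n, of x y]
    by (intro le_divide_max_powr[of n _ S k _ _ D0 D1]) (auto simp: c_def)
  moreover have "c > 0" by (simp add: c_def)
  ultimately show ?thesis by blast
qed

end
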